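(* Let $r\ge 1$ be a fixed integer and $p_1,\dots,p_r$ fixed distinct primes. For a real $x\ge 1$ and an integer $n\ge 1$ let $L^{(e)}(x,n)$ denote the number of positive integers $k\le x$ such that $k$ and $n$ are exponentially coprime. Then, uniformly for real $x\ge 3$ and integers $n=\prod_{i=1}^r p_i^{a_i}$ with $a_1,\dots,a_r\ge 1$, $$ L^{(e)}(x,n)= \frac1{r!} \left( \prod_{i=1}^r \frac{\phi(a_i)}{a_i \log p_i} \right)(\log x)^r + O\left( (\log x)^{r-1} \sum_{i=1}^r \theta(a_i) \right), $$ where $\phi$ is Euler's totient function, $\theta(a)$ denotes the number of squarefree divisors of $a$, and the implied constant may depend on $r$ and $p_1,\dots,p_r$ but not on $x$ or $a_1,\dots,a_r$.
   Context: Two integers $n,m>1$ are called exponentially coprime if they have the same prime factors, say $n=\prod_{i=1}^r p_i^{a_i}$ and $m=\prod_{i=1}^r p_i^{b_i}$ with $a_i,b_i\ge 1$, and $\gcd(a_i,b_i)=1$ for every $1\le i\le r$. By convention $1$ and $1$ are exponentially coprime, while $1$ and $m>1$ are not exponentially coprime. *)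

theory Defs
  imports Complex_Main "HOL-Number_Theory.Number_Theory" "HOL-Computational_Algebra.Squarefree"
begin

text \<open>
  Positivity is required because \<open>prime_factors 0 = {}\<close>.  As \<open>prime_factors 1 = {}\<close>, the
  conventions that 1 and 1 are exponentially coprime, while 1 and \<open>m > 1\<close> are not, are
  instances of the definition.
\<close>

definition exponentially_coprime :: "nat \<Rightarrow> nat \<Rightarrow> bool" where
  "exponentially_coprime n m \<longleftrightarrow> n > 0 \<and> m > 0 \<and> prime_factors n = prime_factors m \<and>
     (\<forall>q\<in>prime_factors n. coprime (multiplicity q n) (multiplicity q m))"

lemma exponentially_coprime_1_1: "exponentially_coprime 1 1"
  by (simp add: exponentially_coprime_def)

lemma not_exponentially_coprime_1:
  assumes "m > 1"
  shows "\<not> exponentially_coprime 1 m" "\<not> exponentially_coprime m 1"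
proof -
  obtain q where "prime q" "q dvd m"
    using assms prime_factor_nat[of m] by auto
  hence "q \<in> prime_factors m"
    using assms by (auto simp: prime_factors_dvd)
  thus "\<not> exponentially_coprime 1 m" "\<not> exponentially_coprime m 1"
    by (auto simp: exponentially_coprime_def)
qed

definition L_exp :: "real \<Rightarrow> nat \<Rightarrow> nat" where
  "L_exp x n = card {k::nat. 0 < k \<and> real k \<le> x \<and> exponentially_coprime k n}"

definition theta :: "nat \<Rightarrow> nat" where
  "theta a = card {d. d dvd a \<and> squarefree d}"

end

theory Submission imports Defs begin

text \<open>
  Peeling off the power \<open>q ^ b\<close> of one prime, the count for the prime set \<open>insert q S\<close> is the sum
  over \<open>b\<close> coprime to \<open>a q\<close> of the counts for \<open>S\<close> up to \<open>y / q ^ b\<close>, whose main terms are constant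
  multiples of \<open>(ln y - b * ln q) ^ card S\<close>.  The integers coprime to \<open>a\<close> have density
  \<open>totient a / a\<close> with discrepancy at most \<open>theta a\<close>, so Abel summation against this decreasing
  function costs \<open>theta (a q) * ln y ^ card S\<close>, and the remaining unweighted sum is a Riemann sum of
  a power.
\<close>

section \<open>Integers coprime to a given integer\<close>

text \<open>Split according to whether \<open>q\<close> divides \<open>b\<close>. The multiples
  \<open>q * k\<close> correspond to \<open>k \<le> t / q\<close>, and since \<open>q\<close>
  differs from every prime \<open>p\<close> in \<open>P\<close>, \<open>p\<close> divides
  \<open>q * k\<close> exactly when it divides \<open>k\<close>.\<close>

lemma card_sifted_insert:
  fixes P :: "nat set" and t :: real
  assumes "prime q" "\<forall>p\<in>P. prime p" "q \<notin> P"
  shows "card {b. 0 < b \<and> real b \<le> t \<and> (\<forall>p\<in>P. \<not> p dvd b)} =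
         card {b. 0 < b \<and> real b \<le> t \<and> (\<forall>p\<in>insert q P. \<not> p dvd b)} +
         card {b. 0 < b \<and> real b \<le> t / real q \<and> (\<forall>p\<in>P. \<not> p dvd b)}"
    (is "card ?A = card ?B + card ?C")
proof -
  have q: "q > 0" using assms(1) by (simp add: prime_gt_0_nat)
  have ndvd: "p dvd q * b \<longleftrightarrow> p dvd b" "p dvd b * q \<longleftrightarrow> p dvd b" if "p \<in> P" for p b
    using assms that by (metis prime_dvd_mult_iff primes_dvd_imp_eq)+
  have eq: "?A = ?B \<union> (\<lambda>b. q * b) ` ?C"
  proof (intro equalityI subsetI)
    fix b assume b: "b \<in> ?A"
    show "b \<in> ?B \<union> (\<lambda>b. q * b) ` ?C"
    proof (cases "q dvd b")
      case True
      then obtain k where k: "b = q * k" by auto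
      with b q have "k \<in> ?C" by (auto simp: field_simps ndvd)
      with k show ?thesis by auto
    qed (use b in auto)
  next
    fix b assume "b \<in> ?B \<union> (\<lambda>b. q * b) ` ?C"
    thus "b \<in> ?A" using q by (auto simp: field_simps ndvd)
  qed
  have fin: "finite ?B" "finite ?C"
    by (rule finite_subset[of _ "{..nat \<lfloor>t\<rfloor>}"]; force simp: le_nat_floor)
       (rule finite_subset[of _ "{..nat \<lfloor>t / real q\<rfloor>}"]; force simp: le_nat_floor)
  have "card ?A = card ?B + card ((\<lambda>b. q * b) ` ?C)"
    unfolding eq by (rule card_Un_disjoint) (use fin in auto)
  also have "card ((\<lambda>b. q * b) ` ?C) = card ?C"
    by (rule card_image) (use q in \<open>auto simp: inj_on_def\<close>)
  finally show ?thesis .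
qed

text \<open>Legendre's sieve: admitting a prime \<open>q\<close> replaces the count
  \<open>N(t)\<close> by \<open>N(t) - N(t / q)\<close> and multiplies the density by
  \<open>1 - 1 / q\<close>, so each prime at most doubles the error. A real cutoff \<open>t\<close>,
  arbitrary in the induction, is what allows the passage to \<open>t / q\<close>.\<close>

lemma card_sifted_bound:
  fixes P :: "nat set" and t :: real
  assumes "finite P" "\<forall>p\<in>P. prime p" "t \<ge> 0"
  shows "\<bar>real (card {b. 0 < b \<and> real b \<le> t \<and> (\<forall>p\<in>P. \<not> p dvd b)}) - (\<Prod>p\<in>P. 1 - 1 / real p) * t\<bar>
         \<le> 2 ^ card P"
  using assms
proof (induction P arbitrary: t rule: finite_induct)
  case empty
  have "{b. 0 < b \<and> real b \<le> t} = {1..nat \<lfloor>t\<rfloor>}"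
    using empty.prems by (auto simp: le_nat_floor le_nat_iff le_floor_iff)
  then have "card {b. 0 < b \<and> real b \<le> t} = nat \<lfloor>t\<rfloor>" by simp
  \<comment> \<open>With no primes the error is the fractional part of \<open>t\<close>, which is
    below \<open>1 = 2 ^ 0\<close>.\<close>
  then show ?case using empty.prems by (simp add: abs_if) linarith
next
  case (insert q P)
  let ?N = "\<lambda>Q t. real (card {b. 0 < b \<and> real b \<le> t \<and> (\<forall>p\<in>Q. \<not> p dvd b)})"
  let ?R = "\<Prod>p\<in>P. 1 - 1 / real p"
  have "?N P t = ?N (insert q P) t + ?N P (t / real q)"
    using card_sifted_insert[of q P t] insert by simp
  moreover have "\<bar>?N P t - ?R * t\<bar> \<le> 2 ^ card P" using insert by simp
  moreover have "\<bar>?N P (t / real q) - ?R * (t / real q)\<bar> \<le> 2 ^ card P"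
    by (rule insert.IH) (use insert.prems in auto)
  moreover have "(\<Prod>p\<in>insert q P. 1 - 1 / real p) * t = ?R * t - ?R * (t / real q)"
    using insert.hyps by (simp add: algebra_simps)
  moreover have "2 ^ card (insert q P) = 2 ^ card P + (2 ^ card P :: real)"
    using insert.hyps by simp
  ultimately show ?case by linarith
qed

text \<open>Each set of prime factors of \<open>a\<close> has a squarefree product dividing
  \<open>a\<close>, and the set is recovered as the prime factors of that product, so distinct
  subsets give distinct divisors.\<close>

lemma power_card_prime_factors_le_theta:
  assumes "a \<ge> 1"
  shows "2 ^ card (prime_factors a) \<le> theta a"
proof -
  have fin: "finite {d. d dvd a \<and> squarefree d}"
    by (rule finite_subset[of _ "{..a}"]) (use assms in \<open>auto dest: dvd_imp_le\<close>)
  have pf: "prime_factors (\<Prod>Q) = Q" if "Q \<subseteq> prime_factors a" for Q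
  proof -
    have "finite Q" using that finite_subset by blast
    then show ?thesis using that
    proof (induction Q rule: finite_induct)
      case (insert q Q)
      then have "prime q" "prime_factors (\<Prod>Q) = Q" "\<Prod>Q \<noteq> 0" by auto
      then show ?case using insert.hyps
        by (simp add: prime_factors_product prime_prime_factors)
    qed simp
  qed
  have "card (Pow (prime_factors a)) \<le> card {d. d dvd a \<and> squarefree d}"
  proof (rule card_inj_on_le[of Prod, OF _ _ fin])
    show "inj_on Prod (Pow (prime_factors a))"
      by (rule inj_onI) (metis pf PowD)
    show "Prod ` Pow (prime_factors a) \<subseteq> {d. d dvd a \<and> squarefree d}"
    proof safe
      fix Q assume Q: "Q \<subseteq> prime_factors a"
      have "\<Prod>Q dvd \<Prod>(prime_factors a)"
        by (rule prod_dvd_prod_subset) (use Q in auto)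
      also have "\<Prod>(prime_factors a) dvd a"
      proof -
        have "(\<Prod>p\<in>prime_factors a. p) dvd (\<Prod>p\<in>prime_factors a. p ^ multiplicity p a)"
          by (rule prod_dvd_prod) (auto simp: prime_factors_multiplicity intro!: dvd_power)
        also have "\<dots> = a" using prime_factorization_nat[of a] assms by simp
        finally show ?thesis by simp
      qed
      finally show "\<Prod>Q dvd a" .
      show "squarefree (\<Prod>Q)"
      proof (rule squarefree_prod_coprime)
        show "coprime u v" if "u \<in> Q" "v \<in> Q" "u \<noteq> v" for u v
          using that Q by (intro primes_coprime) auto
        show "squarefree u" if "u \<in> Q" for u
          using that Q by (intro squarefree_prime) auto
      qed
    qed
  qed
  then show ?thesis by (simp add: theta_def card_Pow)
qed

text \<open>Coprimality to \<open>a\<close> means that no prime factor of \<open>a\<close> divides,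
  so the sieve applies with the prime factors of \<open>a\<close>. Its density is
  \<open>totient a / a\<close> by Euler's product, and its error is at most
  \<open>theta a\<close>.\<close>

lemma card_coprime_bound:
  assumes "a \<ge> 1"
  shows "\<bar>real (card {b\<in>{1..n}. coprime b a}) - real (totient a) / real a * real n\<bar> \<le> real (theta a)"
proof -
  have "coprime b a \<longleftrightarrow> (\<forall>p\<in>prime_factors a. \<not> p dvd b)" for b
  proof
    assume "\<forall>p\<in>prime_factors a. \<not> p dvd b"
    then have "\<not> (prime p \<and> p dvd gcd b a)" for p
      using assms by (auto simp: prime_factors_dvd)
    then show "coprime b a"
      using prime_factor_nat coprime_iff_gcd_eq_1 by blast
  next
    assume "coprime b a"
    then show "\<forall>p\<in>prime_factors a. \<not> p dvd b"
      by (metis coprime_common_divisor in_prime_factors_iff not_prime_unit)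
  qed
  then have "{b\<in>{1..n}. coprime b a} =
      {b. 0 < b \<and> real b \<le> real n \<and> (\<forall>p\<in>prime_factors a. \<not> p dvd b)}"
    by auto
  moreover have "real (totient a) / real a = (\<Prod>p\<in>prime_factors a. 1 - 1 / real p)"
    using totient_formula2[of a] assms by simp
  moreover have "(2::real) ^ card (prime_factors a) \<le> real (theta a)"
    using power_card_prime_factors_le_theta[OF assms]
    by (metis of_nat_le_iff of_nat_numeral of_nat_power)
  moreover have "\<bar>real (card {b. 0 < b \<and> real b \<le> real n \<and> (\<forall>p\<in>prime_factors a. \<not> p dvd b)})
      - (\<Prod>p\<in>prime_factors a. 1 - 1 / real p) * real n\<bar> \<le> 2 ^ card (prime_factors a)"
    by (rule card_sifted_bound) auto
  ultimately show ?thesis by (simp only:)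
qed

section \<open>Weighted sums\<close>

lemma abs_mult_diff:
  fixes k u v :: "'a :: linordered_idom"
  assumes "k \<ge> 0"
  shows "\<bar>k * u - k * v\<bar> = k * \<bar>u - v\<bar>"
  using assms by (simp add: abs_mult flip: right_diff_distrib)

text \<open>Summation by parts: with partial sums bounded by \<open>B\<close>, the differences of
  the decreasing \<open>f\<close> contribute at most \<open>B * (f 0 - f M)\<close> and the boundary
  term at most \<open>B * f M\<close>.\<close>

lemma abel_sum_bound:
  fixes f d :: "nat \<Rightarrow> real"
  assumes "\<And>n. n < M \<Longrightarrow> f (Suc n) \<le> f n" "f M \<ge> 0"
    and "\<And>n. n \<le> M \<Longrightarrow> \<bar>\<Sum>i=1..n. d i\<bar> \<le> B"
  shows "\<bar>\<Sum>i=1..M. d i * f i\<bar> \<le> B * f 0"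
proof -
  \<comment> \<open>With the boundary term removed, what remains is a sum of partial sums of
    \<open>d\<close> times the decrements of \<open>f\<close>, and the bounds on these
    telescope.\<close>
  have "\<bar>(\<Sum>i=1..n. d i * f i) - (\<Sum>i=1..n. d i) * f n\<bar> \<le> B * (f 0 - f n)" if "n \<le> M" for n
    using that
  proof (induction n)
    case (Suc n)
    have "\<bar>(\<Sum>i=1..n. d i) * (f n - f (Suc n))\<bar> \<le> B * (f n - f (Suc n))"
      using assms(1)[of n] assms(3)[of n] Suc.prems by (simp add: abs_mult mult_right_mono)
    moreover have "(\<Sum>i=1..Suc n. d i * f i) - (\<Sum>i=1..Suc n. d i) * f (Suc n)
        = ((\<Sum>i=1..n. d i * f i) - (\<Sum>i=1..n. d i) * f n) + (\<Sum>i=1..n. d i) * (f n - f (Suc n))"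
      by (simp add: algebra_simps)
    ultimately show ?case using Suc by (simp add: algebra_simps)
  qed simp
  from this[of M]
  have "\<bar>(\<Sum>i=1..M. d i * f i) - (\<Sum>i=1..M. d i) * f M\<bar> \<le> B * (f 0 - f M)" by simp
  moreover have "\<bar>(\<Sum>i=1..M. d i) * f M\<bar> \<le> B * f M"
    using assms by (simp add: abs_mult mult_right_mono)
  ultimately show ?thesis by (simp add: algebra_simps)
qed

text \<open>The mean value estimate for the power \<open>r + 1\<close>, obtained algebraically:
  \<open>u - v\<close> factors out, and each of the \<open>r + 1\<close> terms of the cofactor lies
  between \<open>v ^ r\<close> and \<open>u ^ r\<close>.\<close>

lemma power_Suc_diff_bounds:
  fixes u v :: real
  assumes "0 \<le> v" "v \<le> u"
  shows "real (Suc r) * (u - v) * v ^ r \<le> u ^ Suc r - v ^ Suc r"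
    and "u ^ Suc r - v ^ Suc r \<le> real (Suc r) * (u - v) * u ^ r"
proof -
  have *: "u ^ Suc r - v ^ Suc r = (u - v) * (\<Sum>i<Suc r. u ^ i * v ^ (r - i))"
    using diff_power_eq_sum[of u r v] by simp
  have le: "v ^ r \<le> u ^ i * v ^ (r - i)" "u ^ i * v ^ (r - i) \<le> u ^ r" if "i < Suc r" for i
  proof -
    have "v ^ r = v ^ i * v ^ (r - i)" "u ^ r = u ^ i * u ^ (r - i)"
      using that by (simp_all flip: power_add)
    then show "v ^ r \<le> u ^ i * v ^ (r - i)" "u ^ i * v ^ (r - i) \<le> u ^ r"
      using assms by (auto intro!: mult_right_mono mult_left_mono power_mono)
  qed
  have "(\<Sum>i<Suc r. v ^ r) \<le> (\<Sum>i<Suc r. u ^ i * v ^ (r - i))"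
    by (rule sum_mono) (use le in auto)
  with assms have "(u - v) * (real (Suc r) * v ^ r) \<le> (u - v) * (\<Sum>i<Suc r. u ^ i * v ^ (r - i))"
    by (intro mult_left_mono) auto
  then show "real (Suc r) * (u - v) * v ^ r \<le> u ^ Suc r - v ^ Suc r"
    unfolding * by (simp only: mult_ac)
  have "(\<Sum>i<Suc r. u ^ i * v ^ (r - i)) \<le> (\<Sum>i<Suc r. u ^ r)"
    by (rule sum_mono) (use le in auto)
  with assms have "(u - v) * (\<Sum>i<Suc r. u ^ i * v ^ (r - i)) \<le> (u - v) * (real (Suc r) * u ^ r)"
    by (intro mult_left_mono) auto
  then show "u ^ Suc r - v ^ Suc r \<le> real (Suc r) * (u - v) * u ^ r"
    unfolding * by (simp only: mult_ac)
qed

text \<open>The function \<open>g\<close> is, up to the factor \<open>k = (r + 1) * c\<close>, a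
  discrete antiderivative of \<open>f\<close>: its decrements lie between \<open>k\<close> times
  neighbouring values of \<open>f\<close>. Telescoping traps the sum. The hypotheses on
  \<open>M\<close> say that the sampling stops within one step \<open>c\<close> of the zero of
  \<open>T - b * c\<close>.\<close>

lemma power_riemann_sum:
  fixes T c :: real
  assumes "c > 0" "real M * c \<le> T" "T \<le> real (Suc M) * c"
  shows "\<bar>(\<Sum>b=1..M. (T - real b * c) ^ r) - T ^ Suc r / (real (Suc r) * c)\<bar> \<le> 2 * T ^ r"
proof -
  define f where "f = (\<lambda>b. (T - real b * c) ^ r)"
  define g where "g = (\<lambda>b. (T - real b * c) ^ Suc r)"
  define k where "k = real (Suc r) * c"
  have k: "k > 0" using assms(1) by (simp add: k_def)
  have T: "T \<ge> 0" using assms by (smt (verit) mult_nonneg_nonneg of_nat_0_le_iff)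
  have step: "k * f (Suc n) \<le> g n - g (Suc n)" "g n - g (Suc n) \<le> k * f n" if "Suc n \<le> M" for n
  proof -
    have "real (Suc n) * c \<le> T" using that assms
      by (meson mult_right_mono of_nat_le_iff less_imp_le order_trans)
    then have "0 \<le> T - real (Suc n) * c" "T - real (Suc n) * c \<le> T - real n * c"
      using assms(1) by (auto simp: algebra_simps)
    from power_Suc_diff_bounds[OF this, of r]
    show "k * f (Suc n) \<le> g n - g (Suc n)" "g n - g (Suc n) \<le> k * f n"
      by (simp_all add: f_def g_def k_def algebra_simps)
  qed
  \<comment> \<open>The upper estimate naturally involves the sum over \<open>0..n-1\<close>; the
    correction \<open>f 0 - f n\<close> moves it to \<open>1..n\<close>.\<close>
  have "k * (\<Sum>b=1..n. f b) \<le> g 0 - g n \<and> g 0 - g n \<le> k * ((\<Sum>b=1..n. f b) + f 0 - f n)"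
    if "n \<le> M" for n
    using that
  proof (induction n)
    case (Suc n)
    then show ?case using step[of n] by (simp add: algebra_simps)
  qed simp
  from this[of M]
  have 1: "k * (\<Sum>b=1..M. f b) \<le> g 0 - g M" "g 0 - g M \<le> k * ((\<Sum>b=1..M. f b) + f 0 - f M)"
    by auto
  have u: "0 \<le> T - real M * c" "T - real M * c \<le> c" "T - real M * c \<le> T"
    using assms by (auto simp: algebra_simps)
  have fM: "0 \<le> f M" "f M \<le> T ^ r" unfolding f_def using u by (auto intro: power_mono)
  \<comment> \<open>The leftover endpoint value costs at most \<open>T ^ r\<close> after division by
    \<open>k\<close>, because \<open>T - M * c \<le> c \<le> k\<close>. The term
    \<open>f 0 = T ^ r\<close> costs the same again, whence the constant 2.\<close>
  have "g M = (T - real M * c) * f M" by (simp add: g_def f_def)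
  also have "\<dots> \<le> k * T ^ r"
  proof (rule mult_mono)
    show "T - real M * c \<le> k" using u assms(1)
      by (smt (verit) k_def mult_le_cancel_right1 of_nat_1 of_nat_le_iff Suc_le_mono le0 One_nat_def)
  qed (use fM k in auto)
  finally have gM: "g M \<le> k * T ^ r" .
  have "g M \<ge> 0" unfolding g_def using u by simp
  then have "k * (\<Sum>b=1..M. f b) \<le> T ^ Suc r" using 1 by (simp add: g_def)
  moreover have "T ^ Suc r \<le> k * ((\<Sum>b=1..M. f b) + 2 * T ^ r)"
  proof -
    have "k * f M \<ge> 0" using k fM by simp
    then show ?thesis using 1 gM by (simp add: g_def f_def algebra_simps)
  qed
  ultimately have "(\<Sum>b=1..M. f b) \<le> T ^ Suc r / k" "T ^ Suc r / k \<le> (\<Sum>b=1..M. f b) + 2 * T ^ r"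
    using k by (simp_all add: field_simps)
  moreover have "T ^ r \<ge> 0" using T by simp
  ultimately show ?thesis unfolding f_def k_def by linarith
qed

text \<open>Write the indicator of coprimality as its density \<open>\<rho>\<close> plus a
  fluctuation. Abel summation bounds the fluctuating part by \<open>theta a * T ^ r\<close>, and the
  constant part is a Riemann sum with error \<open>2 * T ^ r\<close>; together they give the
  constant 3.\<close>

lemma coprime_power_sum:
  fixes T c :: real
  assumes "a \<ge> 1" "c > 0" "real M * c \<le> T" "T \<le> real (Suc M) * c"
  shows "\<bar>(\<Sum>b | b \<in> {1..M} \<and> coprime b a. (T - real b * c) ^ r)
           - real (totient a) / real a * (T ^ Suc r / (real (Suc r) * c))\<bar>
         \<le> 3 * real (theta a) * T ^ r"
proof -
  define \<rho> where "\<rho> = real (totient a) / real a"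
  define \<chi> where "\<chi> = (\<lambda>b. if coprime b a then 1 else 0 :: real)"
  have T: "T \<ge> 0" using assms by (smt (verit) mult_nonneg_nonneg of_nat_0_le_iff)
  have \<rho>: "0 \<le> \<rho>" "\<rho> \<le> 1"
    using assms(1) totient_le[of a] by (auto simp: \<rho>_def divide_le_eq)
  \<comment> \<open>Since \<open>\<rho> \<le> 1 \<le> theta a\<close>, the error of the Riemann sum
    can also be expressed through \<open>theta a\<close>.\<close>
  have "(1::nat) \<le> 2 ^ card (prime_factors a)" by simp
  also have "\<dots> \<le> theta a" by (rule power_card_prime_factors_le_theta[OF assms(1)])
  finally have \<theta>: "real (theta a) \<ge> 1" by simp
  have D: "\<bar>\<Sum>i=1..n. \<chi> i - \<rho>\<bar> \<le> real (theta a)" for n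
  proof -
    have "(\<Sum>i=1..n. \<chi> i) = real (card {b\<in>{1..n}. coprime b a})"
      by (simp add: \<chi>_def sum.If_cases Int_def)
    then show ?thesis using card_coprime_bound[OF assms(1), of n]
      by (simp add: sum_subtractf \<rho>_def mult.commute)
  qed
  have "\<bar>\<Sum>i=1..M. (\<chi> i - \<rho>) * (T - real i * c) ^ r\<bar> \<le> real (theta a) * (T - real 0 * c) ^ r"
  proof (rule abel_sum_bound[where f = "\<lambda>i. (T - real i * c) ^ r"])
    fix n assume "n < M"
    then have "real (Suc n) * c \<le> T" using assms
      by (meson mult_right_mono of_nat_le_iff less_imp_le order_trans Suc_leI)
    then show "(T - real (Suc n) * c) ^ r \<le> (T - real n * c) ^ r"
      using assms(2) by (intro power_mono) (auto simp: algebra_simps)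
  qed (use assms D in auto)
  moreover have "(\<Sum>i=1..M. (\<chi> i - \<rho>) * (T - real i * c) ^ r)
      = (\<Sum>b | b \<in> {1..M} \<and> coprime b a. (T - real b * c) ^ r) - \<rho> * (\<Sum>i=1..M. (T - real i * c) ^ r)"
  proof -
    have "(\<Sum>i=1..M. \<chi> i * (T - real i * c) ^ r)
      = (\<Sum>i\<in>{1..M}. if coprime i a then (T - real i * c) ^ r else 0)"
      by (rule sum.cong) (auto simp: \<chi>_def)
    also have "\<dots> = (\<Sum>b | b \<in> {1..M} \<and> coprime b a. (T - real b * c) ^ r)"
      by (simp add: sum.If_cases Int_def)
    finally show ?thesis by (simp add: left_diff_distrib sum_subtractf sum_distrib_left)
  qed
  moreover have "\<bar>\<rho> * (\<Sum>i=1..M. (T - real i * c) ^ r) - \<rho> * (T ^ Suc r / (real (Suc r) * c))\<bar>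
      \<le> 2 * (real (theta a) * T ^ r)"
  proof -
    have "\<rho> * \<bar>(\<Sum>i=1..M. (T - real i * c) ^ r) - T ^ Suc r / (real (Suc r) * c)\<bar>
       \<le> real (theta a) * (2 * T ^ r)"
      by (rule mult_mono) (use \<rho> \<theta> power_riemann_sum[OF assms(2-4), of r] in auto)
    then show ?thesis
      unfolding abs_mult_diff[OF \<rho>(1)] by (simp only: mult.left_commute)
  qed
  ultimately show ?thesis unfolding \<rho>_def[symmetric] by (simp add: mult_ac)
qed

section \<open>Splitting off one prime\<close>

text \<open>Exponents are indexed by the primes themselves and the cutoff is real, so that removing
  one prime from \<open>S\<close> and dividing the cutoff by its power stays within the same
  family.\<close>

definition exp_coprime_upto :: "nat set \<Rightarrow> (nat \<Rightarrow> nat) \<Rightarrow> real \<Rightarrow> nat set" where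
  "exp_coprime_upto S a y =
     {k. 0 < k \<and> real k \<le> y \<and> prime_factors k = S \<and> (\<forall>q\<in>S. coprime (multiplicity q k) (a q))}"

lemma finite_exp_coprime_upto: "finite (exp_coprime_upto S a y)"
  by (rule finite_subset[of _ "{..nat \<lfloor>y\<rfloor>}"]) (auto simp: exp_coprime_upto_def le_nat_floor)

text \<open>Unique factorization \<open>n = q ^ b * k\<close> with \<open>q\<close> not dividing
  \<open>k\<close> gives a bijection onto pairs \<open>(b, k)\<close>. The bound \<open>M\<close>
  only has to cover every exponent that can occur: for larger powers of \<open>q\<close> the cutoff
  is already exceeded.\<close>

lemma card_exp_coprime_upto_insert:
  fixes y :: real
  assumes "prime q" "q \<notin> S" "\<And>b. b \<ge> 1 \<Longrightarrow> real q ^ b \<le> y \<Longrightarrow> b \<le> M"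
  shows "card (exp_coprime_upto (insert q S) a y) =
         (\<Sum>b | b \<in> {1..M} \<and> coprime b (a q). card (exp_coprime_upto S a (y / real q ^ b)))"
proof -
  let ?B = "{b. b \<in> {1..M} \<and> coprime b (a q)}"
  let ?X = "SIGMA b:?B. exp_coprime_upto S a (y / real q ^ b)"
  have q: "q > 0" using assms(1) by (simp add: prime_gt_0_nat)
  have pf: "prime_factors (q ^ b * k) = insert q (prime_factors k)" if "b \<ge> 1" "k > 0" for b k
    using that assms(1) q by (simp add: prime_factors_product prime_factors_power prime_prime_factors)
  have mult_q: "multiplicity q (q ^ b * k) = b" if "\<not> q dvd k" for b k
  proof -
    have "k \<noteq> 0" using that by (intro notI) simp
    then show ?thesis using that assms(1) q
      by (simp add: prime_elem_multiplicity_mult_distrib not_dvd_imp_multiplicity_0)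
  qed
  have mult_s: "multiplicity s (q ^ b * k) = multiplicity s k"
    if "k > 0" "s \<in> prime_factors k" "s \<noteq> q" for s b k
    using that assms(1) q
    by (simp add: prime_elem_multiplicity_mult_distrib multiplicity_distinct_prime_power
        in_prime_factors_imp_prime)
  have "bij_betw (\<lambda>(b, k). q ^ b * k) ?X (exp_coprime_upto (insert q S) a y)"
    unfolding bij_betw_def
  proof
    have ndvd: "\<not> q dvd k" if "k \<in> exp_coprime_upto S a z" for k z
      using that assms by (auto simp: exp_coprime_upto_def prime_factors_dvd)
    show "inj_on (\<lambda>(b, k). q ^ b * k) ?X"
    proof (rule inj_onI, clarify)
      fix b k b' k'
      assume *: "q ^ b * k = q ^ b' * k'" "k \<in> exp_coprime_upto S a (y / real q ^ b)"
        "k' \<in> exp_coprime_upto S a (y / real q ^ b')"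
      \<comment> \<open>The exponent is determined as the multiplicity of \<open>q\<close> in the
        common product.\<close>
      then have "b = b'" using mult_q[of k b] mult_q[of k' b'] ndvd by metis
      with * q show "b = b' \<and> k = k'" by simp
    qed
    show "(\<lambda>(b, k). q ^ b * k) ` ?X = exp_coprime_upto (insert q S) a y"
    proof (intro equalityI subsetI)
      fix n assume "n \<in> (\<lambda>(b, k). q ^ b * k) ` ?X"
      then obtain b k where n: "n = q ^ b * k" and b: "b \<in> ?B"
        and k: "k \<in> exp_coprime_upto S a (y / real q ^ b)" by auto
      have "real q ^ b * real k \<le> y" using k q by (simp add: exp_coprime_upto_def field_simps)
      with n b k ndvd[OF k] show "n \<in> exp_coprime_upto (insert q S) a y"
        using pf[of b k] mult_q[of k b] mult_s[of k _ b] assms(2) q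
        by (auto simp: exp_coprime_upto_def) metis
    next
      fix n assume n: "n \<in> exp_coprime_upto (insert q S) a y"
      then have n0: "n \<noteq> 0" and qn: "q dvd n" by (auto simp: exp_coprime_upto_def prime_factors_dvd)
      define b where "b = multiplicity q n"
      obtain k where k: "n = q ^ b * k" "\<not> q dvd k"
        using multiplicity_decompose'[of n q] n0 assms(1) unfolding b_def by (auto simp: prime_nat_iff)
      have b1: "b \<ge> 1" using k qn by (cases b) auto
      have k0: "k > 0" using k n0 by (cases k) auto
      have le: "real q ^ b * real k \<le> y" using n k(1) by (simp add: exp_coprime_upto_def)
      \<comment> \<open>As \<open>k \<ge> 1\<close>, the power \<open>q ^ b\<close> itself is at
        most \<open>y\<close>, which brings \<open>b\<close> within the range of the sum.\<close>
      have "real q ^ b * 1 \<le> real q ^ b * real k" using k0 by (intro mult_left_mono) auto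
      then have "b \<le> M" using assms(3) b1 le by simp
      moreover have "coprime b (a q)" using n by (simp add: exp_coprime_upto_def b_def)
      moreover have "q \<notin> prime_factors k" using k by auto
      then have S: "prime_factors k = S"
        using pf[OF b1 k0] n k(1) assms(2) by (auto simp: exp_coprime_upto_def)
      moreover have "coprime (multiplicity s k) (a s)" if "s \<in> S" for s
      proof -
        have "multiplicity s n = multiplicity s k"
          using mult_s[OF k0, of s b] that S k(1) assms(2) by auto
        moreover have "coprime (multiplicity s n) (a s)"
          using n that by (simp add: exp_coprime_upto_def)
        ultimately show ?thesis by simp
      qed
      ultimately have "(b, k) \<in> ?X"
        using b1 k0 le q by (auto simp: exp_coprime_upto_def field_simps)
      with k(1) show "n \<in> (\<lambda>(b, k). q ^ b * k) ` ?X" by force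
    qed
  qed
  then have "card (exp_coprime_upto (insert q S) a y) = card ?X"
    by (simp add: bij_betw_same_card)
  also have "\<dots> = (\<Sum>b | b \<in> {1..M} \<and> coprime b (a q). card (exp_coprime_upto S a (y / real q ^ b)))"
    by (rule card_SigmaI) (auto simp: finite_exp_coprime_upto)
  finally show ?thesis .
qed

section \<open>Asymptotics for a finite set of primes, by induction on the set\<close>

lemma card_exp_coprime_upto_bound:
  fixes S :: "nat set"
  assumes "finite S" "\<forall>q\<in>S. prime q"
  shows "\<exists>C\<ge>0. \<forall>a y. y \<ge> 1 \<longrightarrow> (\<forall>q\<in>S. a q \<ge> 1) \<longrightarrow>
    \<bar>real (card (exp_coprime_upto S a y))
       - 1 / fact (card S) * (\<Prod>q\<in>S. real (totient (a q)) / (real (a q) * ln (real q))) * ln y ^ card S\<bar>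
    \<le> C * ((1 + ln y) ^ (card S - 1) * (\<Sum>q\<in>S. real (theta (a q))))"
  using assms
proof (induction S rule: finite_induct)
  case empty
  \<comment> \<open>The only integer without prime factors is 1, and the main term is also 1, so the
    estimate is exact and \<open>C = 0\<close> serves.\<close>
  have "exp_coprime_upto {} a y = {1}" if "y \<ge> 1" for a y
    using that by (auto simp: exp_coprime_upto_def prime_factorization_empty_iff)
  then show ?case by (auto intro!: exI[of _ 0])
next
  case (insert q S)
  let ?r = "card S"
  let ?main = "\<lambda>S a. 1 / fact (card S) * (\<Prod>q\<in>S. real (totient (a q)) / (real (a q) * ln (real q)))"
  from insert obtain C where C: "C \<ge> 0" and IH:
    "\<And>a y. y \<ge> 1 \<Longrightarrow> \<forall>q\<in>S. a q \<ge> 1 \<Longrightarrow>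
      \<bar>real (card (exp_coprime_upto S a y)) - ?main S a * ln y ^ ?r\<bar>
      \<le> C * ((1 + ln y) ^ (?r - 1) * (\<Sum>q\<in>S. real (theta (a q))))"
    by auto
  define c where "c = ln (real q)"
  have q: "real q > 1" using insert.prems prime_gt_1_nat[of q] by simp
  have c: "c > 0" using q by (simp add: c_def)
  \<comment> \<open>\<open>W\<close> dominates the leading coefficient for \<open>S\<close>
    independently of \<open>a\<close>, because \<open>totient (a s) \<le> a s\<close>. This keeps
    the new constant \<open>C / c + 3 * W\<close> uniform in the exponents.\<close>
  define W where "W = (\<Prod>q\<in>S. 1 / ln (real q))"
  have lnS: "ln (real s) > 0" if "s \<in> S" for s
    using that insert.prems prime_gt_1_nat[of s] by simp
  have W: "W \<ge> 0" unfolding W_def using lnS by (intro prod_nonneg) (force simp: less_imp_le)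
  have bound: "\<bar>real (card (exp_coprime_upto (insert q S) a y)) - ?main (insert q S) a * ln y ^ Suc ?r\<bar>
     \<le> (C / c + 3 * W) * ((1 + ln y) ^ ?r * (\<Sum>q\<in>insert q S. real (theta (a q))))"
    if y: "y \<ge> 1" and a: "\<forall>q\<in>insert q S. a q \<ge> 1" for a and y :: real
  proof -
    define T where "T = ln y"
    have T: "T \<ge> 0" using y by (simp add: T_def)
    \<comment> \<open>This is the largest exponent \<open>b\<close> with
      \<open>q ^ b \<le> y\<close>, read off on the logarithmic scale.\<close>
    define M where "M = nat \<lfloor>T / c\<rfloor>"
    have "real M = of_int \<lfloor>T / c\<rfloor>" using T c by (simp add: M_def)
    then have "real M \<le> T / c" "T / c \<le> real (Suc M)" by linarith+
    then have M: "real M * c \<le> T" "T \<le> real (Suc M) * c"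
      using c by (simp_all add: field_simps)
    let ?B = "{b. b \<in> {1..M} \<and> coprime b (a q)}"
    let ?\<Theta> = "\<Sum>q\<in>S. real (theta (a q))"
    let ?E = "(1 + T) ^ ?r"
    have ln_eq: "ln (y / real q ^ b) = T - real b * c" for b
      using y q by (simp add: T_def c_def ln_div ln_realpow)
    have pow_le: "real q ^ b \<le> y \<longleftrightarrow> real b * c \<le> T" for b
      using y q ln_eq[of b] ln_le_cancel_iff[of "real q ^ b" y]
      by (simp add: T_def c_def ln_realpow)
    have "b \<le> M" if "real q ^ b \<le> y" for b
      using that c unfolding pow_le M_def by (simp add: le_nat_floor field_simps)
    then have "real (card (exp_coprime_upto (insert q S) a y))
        = (\<Sum>b\<in>?B. real (card (exp_coprime_upto S a (y / real q ^ b))))"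
      using card_exp_coprime_upto_insert[of q S y M a] insert by simp
    \<comment> \<open>Inherited error: each of at most \<open>M \<le> (1 + T) / c\<close> terms has
      an error bounded by its value at \<open>b = 0\<close>, so the power of \<open>1 + T\<close>
      rises by one.\<close>
    moreover have "\<bar>(\<Sum>b\<in>?B. real (card (exp_coprime_upto S a (y / real q ^ b))))
        - ?main S a * (\<Sum>b\<in>?B. (T - real b * c) ^ ?r)\<bar> \<le> C / c * (?E * ?\<Theta>)"
    proof -
      let ?e = "C * ((1 + T) ^ (?r - 1) * ?\<Theta>)"
      have \<Theta>: "?\<Theta> \<ge> 0" by (simp add: sum_nonneg)
      have e0: "?e \<ge> 0" using C T \<Theta> by simp
      have each: "\<bar>real (card (exp_coprime_upto S a (y / real q ^ b)))
          - ?main S a * (T - real b * c) ^ ?r\<bar> \<le> ?e" if "b \<in> ?B" for b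
      proof -
        have "real b * c \<le> real M * c" using that c by simp
        then have bT: "real b * c \<le> T" using M by linarith
        then have "y / real q ^ b \<ge> 1" using pow_le[of b] q by (simp add: field_simps)
        from IH[OF this, of a] a
        have "\<bar>real (card (exp_coprime_upto S a (y / real q ^ b))) - ?main S a * (T - real b * c) ^ ?r\<bar>
          \<le> C * ((1 + (T - real b * c)) ^ (?r - 1) * ?\<Theta>)" unfolding ln_eq by simp
        also have "\<dots> \<le> ?e"
          using C \<Theta> bT c by (intro mult_left_mono mult_right_mono power_mono) auto
        finally show ?thesis .
      qed
      have "\<bar>\<Sum>b\<in>?B. real (card (exp_coprime_upto S a (y / real q ^ b)))
          - ?main S a * (T - real b * c) ^ ?r\<bar> \<le> (\<Sum>b\<in>?B. ?e)"
        using each by (intro order_trans[OF sum_abs sum_mono]) auto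
      also have "\<dots> \<le> real M * ?e"
      proof -
        have "card ?B \<le> card {1..M}" by (rule card_mono) auto
        then show ?thesis using e0 by (simp only: sum_constant) (intro mult_right_mono, auto)
      qed
      also have "\<dots> \<le> (1 + T) / c * ?e"
        using M c e0 by (intro mult_right_mono) (auto simp: field_simps)
      also have "\<dots> = C / c * (((1 + T) * (1 + T) ^ (?r - 1)) * ?\<Theta>)" by simp
      also have "\<dots> = C / c * (?E * ?\<Theta>)"
      \<comment> \<open>For empty \<open>S\<close> the exponent \<open>?r - 1\<close> truncates to 0
        and the powers do not match, but then the sum of the \<open>theta\<close> values vanishes
        and both sides are 0.\<close>
      proof (cases "S = {}")
        case False
        then have "?r > 0" using insert.hyps by (simp add: card_gt_0_iff)
        then have "(1 + T) * (1 + T) ^ (?r - 1) = ?E" by (cases ?r) auto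
        then show ?thesis by simp
      qed simp
      finally show ?thesis by (simp add: sum_subtractf sum_distrib_left)
    qed
    moreover have "\<bar>?main S a * (\<Sum>b\<in>?B. (T - real b * c) ^ ?r) - ?main (insert q S) a * T ^ Suc ?r\<bar>
        \<le> 3 * W * (?E * real (theta (a q)))"
    proof -
      have prod: "0 \<le> (\<Prod>s\<in>S. real (totient (a s)) / (real (a s) * ln (real s)))"
        "(\<Prod>s\<in>S. real (totient (a s)) / (real (a s) * ln (real s))) \<le> W"
      proof -
        have *: "0 \<le> real (totient (a s)) / (real (a s) * ln (real s)) \<and>
          real (totient (a s)) / (real (a s) * ln (real s)) \<le> 1 / ln (real s)" if "s \<in> S" for s
          using lnS[OF that] a that totient_le[of "a s"] by (auto simp: field_simps)
        show "0 \<le> (\<Prod>s\<in>S. real (totient (a s)) / (real (a s) * ln (real s)))"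
          using * by (intro prod_nonneg) auto
        show "(\<Prod>s\<in>S. real (totient (a s)) / (real (a s) * ln (real s))) \<le> W"
          unfolding W_def using * by (intro prod_mono) auto
      qed
      have m0: "?main S a \<ge> 0" using prod by simp
      have "1 / fact ?r \<le> (1::real)" by (simp add: fact_ge_1)
      then have m1: "?main S a \<le> W" using mult_mono[of "1 / fact ?r" 1, OF _ prod(2)] prod by simp
      let ?s = "(\<Sum>b\<in>?B. (T - real b * c) ^ ?r)"
      let ?g = "real (totient (a q)) / real (a q) * (T ^ Suc ?r / (real (Suc ?r) * c))"
      \<comment> \<open>The Riemann sum supplies \<open>1 / (r + 1)\<close>, which turns
        \<open>1 / r!\<close> into \<open>1 / (r + 1)!\<close>, and the factor
        \<open>1 / ln q\<close> belonging to the new prime.\<close>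
      have "?main (insert q S) a * T ^ Suc ?r = ?main S a * ?g"
        using insert.hyps by (simp add: c_def field_simps)
      then have "\<bar>?main S a * ?s - ?main (insert q S) a * T ^ Suc ?r\<bar> = ?main S a * \<bar>?s - ?g\<bar>"
        using abs_mult_diff[OF m0] by (simp only:)
      also have "\<dots> \<le> W * (3 * real (theta (a q)) * T ^ ?r)"
        using coprime_power_sum[of "a q" c M T ?r] a c M m0 m1 W by (intro mult_mono) auto
      also have "\<dots> \<le> W * (3 * real (theta (a q)) * ?E)"
        using W T by (intro mult_left_mono power_mono) auto
      finally show ?thesis by (simp add: mult_ac)
    qed
    ultimately have "\<bar>real (card (exp_coprime_upto (insert q S) a y)) - ?main (insert q S) a * T ^ Suc ?r\<bar>
        \<le> C / c * (?E * ?\<Theta>) + 3 * W * (?E * real (theta (a q)))"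
      by linarith
    also have "\<dots> \<le> (C / c + 3 * W) * (?E * (?\<Theta> + real (theta (a q))))"
    proof -
      have "0 \<le> C / c * (?E * real (theta (a q)))" "0 \<le> 3 * W * (?E * ?\<Theta>)"
        using C c T W by (auto intro!: mult_nonneg_nonneg sum_nonneg)
      then show ?thesis by (simp add: distrib_left distrib_right)
    qed
    finally show ?thesis using insert.hyps by (simp add: T_def add.commute)
  qed
  have "C / c + 3 * W \<ge> 0" using C c W by simp
  moreover have "card (insert q S) = Suc ?r" using insert.hyps by simp
  ultimately show ?case using bound
    by (intro exI[of _ "C / c + 3 * W"]) (simp only: diff_Suc_1, blast)
qed

section \<open>Translation to \<open>L_exp\<close> and to enumerated primes\<close>

lemma L_exp_eq_card:
  assumes "finite S" "\<forall>q\<in>S. prime q" "\<forall>q\<in>S. a q \<ge> 1"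
  shows "L_exp x (\<Prod>q\<in>S. q ^ a q) = card (exp_coprime_upto S a x)"
proof -
  let ?n = "\<Prod>q\<in>S. q ^ a q"
  have n: "?n > 0" using assms by (auto intro!: prod_pos simp: prime_gt_0_nat)
  have m: "multiplicity q ?n = (if q \<in> S then a q else 0)" if "prime q" for q
    using multiplicity_prod_prime_powers[of S q a] assms that by auto
  \<comment> \<open>All exponents are at least 1, so every prime of \<open>S\<close> really divides
    the product.\<close>
  have pf: "prime_factors ?n = S"
    using m assms n by (auto simp: prime_factors_multiplicity split: if_splits)
  show ?thesis
    unfolding L_exp_def exp_coprime_upto_def exponentially_coprime_def pf
    using n m assms(2) by (intro arg_cong[of _ _ card]) auto
qed

theorem theorem1:
  fixes r :: nat and p :: "nat \<Rightarrow> nat"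
  assumes "r \<ge> 1"
    and "\<forall>i\<in>{1..r}. prime (p i)"
    and "inj_on p {1..r}"
  shows "\<exists>C::real. \<forall>x::real. \<forall>a::nat \<Rightarrow> nat.
           x \<ge> 3 \<longrightarrow> (\<forall>i\<in>{1..r}. a i \<ge> 1) \<longrightarrow>
           \<bar>real (L_exp x (\<Prod>i=1..r. p i ^ a i))
             - 1 / fact r * (\<Prod>i=1..r. real (totient (a i)) / (real (a i) * ln (real (p i)))) * ln x ^ r\<bar>
           \<le> C * (ln x ^ (r - 1) * (\<Sum>i=1..r. real (theta (a i))))"
proof -
  let ?S = "p ` {1..r}"
  have card: "card ?S = r" using assms(3) by (simp add: card_image)
  have prime: "\<forall>q\<in>?S. prime q" using assms(2) by auto
  obtain C where C: "C \<ge> 0" and bound: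
    "\<And>a y. y \<ge> 1 \<Longrightarrow> \<forall>q\<in>?S. a q \<ge> 1 \<Longrightarrow>
      \<bar>real (card (exp_coprime_upto ?S a y))
        - 1 / fact r * (\<Prod>q\<in>?S. real (totient (a q)) / (real (a q) * ln (real q))) * ln y ^ r\<bar>
      \<le> C * ((1 + ln y) ^ (r - 1) * (\<Sum>q\<in>?S. real (theta (a q))))"
    using card_exp_coprime_upto_bound[OF _ prime] unfolding card by auto
  show ?thesis
  \<comment> \<open>The factor \<open>2 ^ (r - 1)\<close> pays for replacing \<open>1 + ln x\<close>
    by \<open>2 * ln x\<close>, valid because \<open>x \<ge> 3\<close> exceeds
    \<open>exp 1\<close>.\<close>
  proof (intro exI[of _ "C * 2 ^ (r - 1)"] allI impI)
    fix x :: real and a :: "nat \<Rightarrow> nat"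
    assume x: "x \<ge> 3" and a: "\<forall>i\<in>{1..r}. a i \<ge> 1"
    \<comment> \<open>Injectivity of \<open>p\<close> allows the exponents to be transported from
      indices to primes.\<close>
    define a' where "a' = a \<circ> the_inv_into {1..r} p"
    have a': "a' (p i) = a i" if "i \<in> {1..r}" for i
      using that assms(3) by (simp add: a'_def the_inv_into_f_f)
    have ge: "\<forall>q\<in>?S. a' q \<ge> 1" using a a' by auto
    have "(\<Prod>i=1..r. p i ^ a i) = (\<Prod>q\<in>?S. q ^ a' q)"
      unfolding prod.reindex[OF assms(3)] using a' by (intro prod.cong) auto
    then have L: "L_exp x (\<Prod>i=1..r. p i ^ a i) = card (exp_coprime_upto ?S a' x)"
      using L_exp_eq_card[OF _ prime ge] by simp
    have P: "(\<Prod>q\<in>?S. real (totient (a' q)) / (real (a' q) * ln (real q)))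
        = (\<Prod>i=1..r. real (totient (a i)) / (real (a i) * ln (real (p i))))"
      unfolding prod.reindex[OF assms(3)] using a' by (intro prod.cong) auto
    have \<Theta>: "(\<Sum>q\<in>?S. real (theta (a' q))) = (\<Sum>i=1..r. real (theta (a i)))"
      unfolding sum.reindex[OF assms(3)] using a' by (intro sum.cong) auto
    have "exp 1 \<le> x" using exp_le x by linarith
    then have "ln x \<ge> 1" using x by (simp add: ln_ge_iff)
    then have "(1 + ln x) ^ (r - 1) \<le> (2 * ln x) ^ (r - 1)" by (intro power_mono) auto
    then have "C * ((1 + ln x) ^ (r - 1) * (\<Sum>i=1..r. real (theta (a i))))
        \<le> C * ((2 * ln x) ^ (r - 1) * (\<Sum>i=1..r. real (theta (a i))))"
      using C by (intro mult_left_mono mult_right_mono) (auto simp: sum_nonneg)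
    with bound[of x a'] x ge
    show "\<bar>real (L_exp x (\<Prod>i=1..r. p i ^ a i))
         - 1 / fact r * (\<Prod>i=1..r. real (totient (a i)) / (real (a i) * ln (real (p i)))) * ln x ^ r\<bar>
       \<le> C * 2 ^ (r - 1) * (ln x ^ (r - 1) * (\<Sum>i=1..r. real (theta (a i))))"
      unfolding L P \<Theta> by (simp add: power_mult_distrib mult_ac)
  qed
qed

end
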